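(* Let $M,N,K,a,b,c$ be non-negative integers, let $\mathbb{K}$ be a field which has either characteristic zero, or characteristic $p>0$ where $M+(c-a)K\le p$. Let $f=x^ay^b(x+y)^c$ and let $I=(x^M,y^N,f^K)\subseteq\mathbb{K}[x,y]$. Fix a monomial order on $\mathbb{K}[x,y]$ with $x>y$. 1. If either $aK\ge M$ or $bK\ge N$, then $\{x^M,y^N\}$ is a Gröbner basis for $I$. 2. If $aK<M$, $bK<N$ and $(a+c)K\ge M$, then $\{x^M,y^N\}\cup\{H_t: 0\le t<M-aK\}$ is a Gröbner basis for $I$, where $$H_t=\sum_{j=0}^{M-aK-t-1}\left(\prod_{\ell=1}^t\frac{M-aK-j-\ell}{M-aK-\ell}\right)\binom{cK+t}{j}x^{aK+j}y^{(b+c)K-j+t}.$$ Thus $I$ has initial ideal $$\operatorname{in}(I)=(x^M,y^N)+\left(x^{M-t-1}y^{(a+b+c)K-M+2t+1}: 0\le t<M-aK\right).$$ 3. If $aK<M$, $bK<N$ and $(a+c)K<M$, then $\{x^M,y^N,x^{aK}y^{bK}(x+y)^{cK}\}\cup\{L_t:0\le t<cK\}$ is a Gröbner basis for $I$, where $$L_t=\sum_{i=0}^{cK-1-t}\left(\sum_{j=i}^{cK-1-t}(-1)^{M-aK-j-t}\left(\frac{\prod_{\ell=1}^t(cK-j-\ell)}{\prod_{\ell=1}^t(cK-\ell)}\right)\binom{M-aK+t}{j}\binom ji\right)x^{i+aK}y^{M+(b-a)K-i+t}.$$ Thus $I$ has initial ideal $$\operatorname{in}(I)=(x^M,y^N,x^{(a+c)K}y^{bK})+\left(x^{(a+c)K-t-1}y^{M+(b-a-c)K+2t+1}:0\le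 t<cK\right).$$
   Context: $K$ is an integer, while $\mathbb{K}$ is the field. $\operatorname{in}(I)$ denotes the initial (leading term) ideal with respect to the fixed monomial order; the index $t$ ranges over integers. The empty product is $1$. *)

theory Defs
  imports "HOL-Library.Poly_Mapping" "HOL-Library.Product_Plus"
    "HOL-Computational_Algebra.Polynomial"
begin

text \<open>
  The polynomial ring in \<open>x\<close> and \<open>y\<close> is the monoid algebra of \<open>nat \<times> nat\<close>: the exponent \<open>(i, j)\<close>
  stands for the monomial \<open>x^i y^j\<close>, and \<^const>\<open>Poly_Mapping.lookup\<close> reads off coefficients.
\<close>

type_synonym 'k poly2 = "(nat \<times> nat) \<Rightarrow>\<^sub>0 'k"

definition X :: "'k::comm_ring_1 poly2"
  where "X = Poly_Mapping.single (1, 0) 1"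

definition Y :: "'k::comm_ring_1 poly2"
  where "Y = Poly_Mapping.single (0, 1) 1"

definition Const :: "'k \<Rightarrow> 'k::comm_ring_1 poly2"
  where "Const q = Poly_Mapping.single 0 q"

definition ideal_gen :: "'a::comm_ring_1 set \<Rightarrow> 'a set"
  where "ideal_gen S = module.span (*) S"

lemma module_times: "module ((*) :: 'a::comm_ring_1 \<Rightarrow> 'a \<Rightarrow> 'a)"
  by unfold_locales (simp_all add: algebra_simps)

definition monomial_order :: "(nat \<times> nat \<Rightarrow> nat \<times> nat \<Rightarrow> bool) \<Rightarrow> bool"
  where "monomial_order le \<longleftrightarrow>
    class.linorder le (\<lambda>u v. le u v \<and> \<not> le v u) \<and>
    (\<forall>u. le 0 u) \<and>
    (\<forall>u v w. le u v \<longrightarrow> le (u + w) (v + w))"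

definition lead_monomial :: "(nat \<times> nat \<Rightarrow> nat \<times> nat \<Rightarrow> bool) \<Rightarrow> 'k::comm_ring_1 poly2 \<Rightarrow> nat \<times> nat"
  where "lead_monomial le p =
    (THE m. m \<in> Poly_Mapping.keys p \<and> (\<forall>n \<in> Poly_Mapping.keys p. le n m))"

text \<open>
  Although \<open>lead_monomial le 0\<close> is unspecified, \<open>lead_term le 0 = 0\<close>, because all coefficients
  of \<open>0\<close> vanish.
\<close>

definition lead_term :: "(nat \<times> nat \<Rightarrow> nat \<times> nat \<Rightarrow> bool) \<Rightarrow> 'k::comm_ring_1 poly2 \<Rightarrow> 'k poly2"
  where "lead_term le p =
    Poly_Mapping.single (lead_monomial le p) (Poly_Mapping.lookup p (lead_monomial le p))"

definition init_ideal :: "(nat \<times> nat \<Rightarrow> nat \<times> nat \<Rightarrow> bool) \<Rightarrow> 'k::comm_ring_1 poly2 set \<Rightarrow> 'k poly2 set"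
  where "init_ideal le I = ideal_gen (lead_term le ` I)"

definition groebner_basis ::
  "(nat \<times> nat \<Rightarrow> nat \<times> nat \<Rightarrow> bool) \<Rightarrow> 'k::comm_ring_1 poly2 set \<Rightarrow> 'k poly2 set \<Rightarrow> bool"
  where "groebner_basis le G I \<longleftrightarrow>
    finite G \<and> G \<subseteq> I \<and> ideal_gen (lead_term le ` G) = init_ideal le I"

text \<open>
  \<open>polyH\<close> is used only when \<open>a K < M \<le> (a + c) K\<close> and \<open>t < M - a K\<close>, and \<open>polyL\<close> only when
  \<open>(a + c) K < M\<close> and \<open>t < c K\<close>. In these ranges none of the subtractions on \<^typ>\<open>nat\<close> below
  truncates.
\<close>

definition polyH :: "nat \<Rightarrow> nat \<Rightarrow> nat \<Rightarrow> nat \<Rightarrow> nat \<Rightarrow> nat \<Rightarrow> 'k::field poly2"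
  where "polyH M K a b c t =
    (\<Sum>j = 0..M - a * K - t - 1.
       Const ((\<Prod>l = 1..t. of_nat (M - a * K - j - l) / of_nat (M - a * K - l))
              * of_nat ((c * K + t) choose j))
       * X ^ (a * K + j) * Y ^ ((b + c) * K - j + t))"

text \<open>The exponent \<open>M + (b - a) K - i + t\<close> of \<open>y\<close> is rearranged, as \<open>b < a\<close> is possible.\<close>

definition polyL :: "nat \<Rightarrow> nat \<Rightarrow> nat \<Rightarrow> nat \<Rightarrow> nat \<Rightarrow> nat \<Rightarrow> 'k::field poly2"
  where "polyL M K a b c t =
    (\<Sum>i = 0..c * K - 1 - t.
       Const (\<Sum>j = i..c * K - 1 - t.
                (- 1) ^ (M - a * K - j - t)
                * ((\<Prod>l = 1..t. of_nat (c * K - j - l)) / (\<Prod>l = 1..t. of_nat (c * K - l)))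
                * of_nat ((M - a * K + t) choose j) * of_nat (j choose i))
       * X ^ (i + a * K) * Y ^ (M + b * K - a * K - i + t))"

end

theory Submission
  imports Defs
begin

text \<open>
  Write \<open>m = M - a K\<close>, \<open>C = c K\<close>, so that \<open>f^K = x^(aK) y^(bK) (x + y)^C\<close>. With \<open>\<theta> = x \<partial>/\<partial>x\<close>, applying
  \<open>(m - 1 - \<theta>) \<cdots> (m - t - \<theta>)\<close> to \<open>(x + y)^(C + t)\<close> leaves a multiple of \<open>(x + y)^C\<close> and kills the
  coefficients of \<open>x^(m - t), \<dots>, x^(m - 1)\<close>. Modulo \<open>x^m\<close> this is, up to a unit, \<open>H\<^sub>t / (x^(aK) y^(bK))\<close>; the
  polynomials \<open>L\<^sub>t\<close> arise in the same way in the variables \<open>x + y\<close> and \<open>- y\<close>.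

  Conversely, a gap in the coefficients of \<open>D (x + y)^C\<close> cannot be longer than \<open>deg D\<close>: otherwise
  a suitable derivative would be divisible by a polynomial of larger degree. This bounds the
  leading monomials of \<open>I\<close>, because in each degree the order is decided by the exponent of \<open>x\<close>.
\<close>

section \<open>Nonzero integers in the field, and multiplicities of univariate polynomials\<close>

lemma of_nat_neq_0_of_less_CHAR:
  assumes "CHAR('a::semiring_1) = 0 \<or> n < CHAR('a)" "0 < n"
  shows "of_nat n \<noteq> (0 :: 'a)"
  using assms by (auto simp: of_nat_eq_0_iff_char_dvd dest: dvd_imp_le)

text \<open>\<open>n!\<close> is a product of integers that are nonzero in the field, and the
  binomial coefficient divides it.\<close>

lemma of_nat_choose_neq_0:
  assumes "CHAR('a::field) = 0 \<or> n < CHAR('a)" "k \<le> n"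
  shows "of_nat (n choose k) \<noteq> (0 :: 'a)"
proof -
  have fact: "of_nat (fact j) \<noteq> (0 :: 'a)" if "CHAR('a) = 0 \<or> j < CHAR('a)" for j
    using that
  proof (induction j)
    case (Suc j)
    moreover have "of_nat (fact (Suc j)) = of_nat (Suc j) * (of_nat (fact j) :: 'a)"
      by (simp only: fact_Suc of_nat_mult of_nat_id)
    ultimately show ?case
      using of_nat_neq_0_of_less_CHAR[where 'a='a, of "Suc j"] by auto
  qed simp
  have "of_nat (fact k * fact (n - k) * (n choose k)) = (of_nat (fact n) :: 'a)"
    using binomial_fact_lemma[OF assms(2)] by simp
  then show ?thesis
    using fact[of n] assms(1) by (metis mult_zero_right of_nat_mult)
qed

lemma linear_power_dvd_pderiv:
  fixes P :: "'a::field poly"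
  assumes "[:c, 1:] ^ Suc n dvd P"
  shows "[:c, 1:] ^ n dvd pderiv P"
proof -
  obtain R where "P = [:c, 1:] ^ Suc n * R"
    using assms by (elim dvdE)
  moreover have D: "pderiv [:c, 1:] = 1"
    by (simp add: pderiv_pCons)
  ultimately have "pderiv P = [:c, 1:] ^ n * ([:c, 1:] * pderiv R + smult (of_nat (Suc n)) R)"
    by (simp only: pderiv_mult pderiv_power_Suc D)
      (simp add: algebra_simps del: of_nat_Suc mult_pCons_left mult_pCons_right)
  then show ?thesis
    by simp
qed

lemma linear_power_dvd_higher_pderiv:
  fixes P :: "'a::field poly"
  assumes "[:c, 1:] ^ (n + s) dvd P"
  shows "[:c, 1:] ^ n dvd (pderiv ^^ s) P"
  using assms
proof (induction s arbitrary: n)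
  case (Suc s)
  from Suc.IH[of "Suc n"] Suc.prems have "[:c, 1:] ^ Suc n dvd (pderiv ^^ s) P"
    by simp
  then show ?case
    by (simp only: funpow.simps comp_apply linear_power_dvd_pderiv)
qed simp

lemma monom_dvd_of_coeff_eq_0:
  fixes P :: "'a::field poly"
  assumes "\<And>k. k < n \<Longrightarrow> coeff P k = 0"
  shows "monom 1 n dvd P"
proof
  show "P = monom 1 n * poly_shift n P"
    by (rule poly_eqI) (use assms in \<open>auto simp: coeff_monom_mult coeff_poly_shift\<close>)
qed

text \<open>The roots 0 and -1 are distinct, so their multiplicities add up: dividing by the power
  of the variable leaves the order at -1 unchanged.\<close>

lemma degree_ge_of_monom_dvd_of_linear_power_dvd:
  fixes P :: "'a::field poly"
  assumes "P \<noteq> 0" "monom 1 n dvd P" "[:1, 1:] ^ r dvd P"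
  shows "n + r \<le> degree P"
proof -
  obtain Q where Q: "P = monom 1 n * Q"
    using assms(2) by (elim dvdE)
  have "Q \<noteq> 0"
    using Q assms(1) by auto
  have "order (-1) (monom (1::'a) n) = 0"
    by (rule order_0I) (simp add: poly_monom)
  then have "order (-1) P = order (-1) Q"
    using Q assms(1) by (simp add: order_mult)
  moreover have "r \<le> order (-1) P"
    using assms(1,3) order_divides[of "-1" r P] by simp
  ultimately have "r \<le> degree Q"
    using order_degree[OF \<open>Q \<noteq> 0\<close>, of "-1"] by simp
  then show ?thesis
    using Q \<open>Q \<noteq> 0\<close> by (simp add: degree_mult_eq degree_monom_eq)
qed

text \<open>
  The \<open>s\<close>-th derivative removes the part below the gap; what remains is divisible by both
  \<open>x^(m - s)\<close> and \<open>(1 + x)^(C - s)\<close>, which exceeds its degree.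
\<close>

lemma no_coefficient_gap:
  fixes E :: "'a::field poly"
  assumes deg: "degree E < m - s" and "s \<le> C"
    and gap: "\<And>k. s \<le> k \<Longrightarrow> k < m \<Longrightarrow> coeff (E * [:1, 1:] ^ C) k = 0"
    and char: "CHAR('a) = 0 \<or> C + m \<le> CHAR('a)"
  shows "E = 0"
proof (rule ccontr)
  assume "E \<noteq> 0"
  define F where "F = E * [:1, 1:] ^ C"
  have F: "F \<noteq> 0"
    using \<open>E \<noteq> 0\<close> by (simp add: F_def)
  have degF: "degree F = degree E + C"
    using \<open>E \<noteq> 0\<close> by (simp add: F_def degree_mult_eq degree_power_eq)
  have coeffs: "coeff ((pderiv ^^ s) F) k = pochhammer (of_nat (Suc k)) s * coeff F (k + s)" for k
    by (simp only: coeff_higher_pderiv)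
  have "(pderiv ^^ s) F = 0"
  proof (rule ccontr)
    assume nz: "(pderiv ^^ s) F \<noteq> 0"
    have "monom 1 (m - s) dvd (pderiv ^^ s) F"
      by (rule monom_dvd_of_coeff_eq_0) (simp only: coeffs, use gap in \<open>simp add: F_def\<close>)
    moreover have "[:1, 1:] ^ (C - s) dvd (pderiv ^^ s) F"
      by (rule linear_power_dvd_higher_pderiv) (use \<open>s \<le> C\<close> in \<open>simp add: F_def\<close>)
    ultimately have "m - s + (C - s) \<le> degree ((pderiv ^^ s) F)"
      by (rule degree_ge_of_monom_dvd_of_linear_power_dvd[OF nz])
    also have "\<dots> \<le> degree F - s"
      by (rule degree_le) (auto simp: coeffs intro: coeff_eq_0)
    finally show False
      using degF deg \<open>s \<le> C\<close> by linarith
  qed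
  \<comment> \<open>Up to the degree of \<open>F\<close>, differentiating \<open>s\<close> times
    multiplies coefficients by units: every factor of the rising factorial is positive and at most
    \<open>degree F\<close>, hence below \<open>C + m\<close>. So the vanishing derivative kills all
    coefficients of \<open>F\<close> from \<open>s\<close> on, including the leading one, as
    \<open>s\<close> \<le> \<open>C\<close> \<le> \<open>degree F\<close>.\<close>
  moreover have "pochhammer (of_nat (Suc k)) s \<noteq> (0 :: 'a)" if "k + s \<le> degree F" for k
  proof -
    have "of_nat (Suc k + i) \<noteq> (0 :: 'a)" if "i < s" for i
      using \<open>k + s \<le> degree F\<close> that degF deg char
      by (intro of_nat_neq_0_of_less_CHAR) auto
    then show ?thesis
      by (simp add: pochhammer_prod del: of_nat_Suc flip: of_nat_add)
  qed
  ultimately have "coeff F (k + s) = 0" if "k + s \<le> degree F" for k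
    using that coeffs[of k] by (simp del: of_nat_Suc)
  moreover have "s \<le> degree F"
    using degF \<open>s \<le> C\<close> by simp
  ultimately have "coeff F (degree F) = 0"
    by (metis le_add_diff_inverse2 order_refl)
  with F show False
    by simp
qed

text \<open>
  Each factor \<open>m - l - \<theta>\<close>, where \<open>\<theta> = x d/dx\<close>, scales the \<open>k\<close>-th coefficient by \<open>m - l - k\<close>
  and costs one power of \<open>1 + x\<close>.
\<close>

fun gap_operator :: "nat \<Rightarrow> nat \<Rightarrow> 'a::field poly \<Rightarrow> 'a poly" where
  "gap_operator m 0 P = P"
| "gap_operator m (Suc t) P =
    (let Q = gap_operator m t P in smult (of_nat m - of_nat (Suc t)) Q - [:0, 1:] * pderiv Q)"

lemma coeff_gap_operator:
  "coeff (gap_operator m t P) k = (\<Prod>l = 1..t. of_nat m - of_nat l - of_nat k) * coeff P k"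
proof (induction t)
  case (Suc t)
  have "coeff ([:0, 1:] * pderiv Q) k = of_nat k * coeff Q k" for Q :: "'a poly"
    by (cases k) (simp_all add: coeff_pCons coeff_pderiv)
  with Suc show ?case
    by (simp add: Let_def algebra_simps)
qed simp

lemma linear_power_dvd_gap_operator:
  "[:1, 1:] ^ (C + t) dvd P \<Longrightarrow> [:1, 1:] ^ C dvd gap_operator m t P"
proof (induction t arbitrary: C)
  case (Suc t)
  have Q: "[:1, 1:] ^ Suc C dvd gap_operator m t P"
    using Suc.IH[of "Suc C"] Suc.prems by simp
  then have "[:1, 1:] ^ C dvd gap_operator m t P"
    by (metis dvd_mult_right power_Suc)
  with linear_power_dvd_pderiv[OF Q] show ?case
    by (simp add: Let_def dvd_smult dvd_diff dvd_mult del: mult_pCons_left)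
qed simp

section \<open>Coefficients and monomials in two variables\<close>

lemma lookup_times_single:
  fixes p :: "'k::comm_ring_1 poly2"
  shows "Poly_Mapping.lookup (p * Poly_Mapping.single (i, j) c) (k, l) =
    (if i \<le> k \<and> j \<le> l then Poly_Mapping.lookup p (k - i, l - j) * c else 0)"
proof (induction p rule: update_induct)
  case (update f n r)
  have "Poly_Mapping.update n r f = f + Poly_Mapping.single n r"
    using update.hyps
    by (intro poly_mapping_eqI) (auto simp: lookup_update lookup_add lookup_single in_keys_iff when_def)
  moreover have "Poly_Mapping.lookup (Poly_Mapping.single n r * Poly_Mapping.single (i, j) c) (k, l) =
    (if i \<le> k \<and> j \<le> l then Poly_Mapping.lookup (Poly_Mapping.single n r) (k - i, l - j) * c else 0)"
    by (cases n) (auto simp: mult_single lookup_single when_def)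
  ultimately show ?case
    using update.IH by (simp add: distrib_right lookup_add)
qed simp

lemma X_power: "X ^ i = Poly_Mapping.single (i, 0) (1 :: 'k::comm_ring_1)"
  by (induction i) (simp_all add: X_def mult_single flip: zero_prod_def)

lemma Y_power: "Y ^ j = Poly_Mapping.single (0, j) (1 :: 'k::comm_ring_1)"
  by (induction j) (simp_all add: Y_def mult_single flip: zero_prod_def)

lemma Const_times_monomial: "Const q * X ^ i * Y ^ j = Poly_Mapping.single (i, j) (q :: 'k::comm_ring_1)"
  by (simp add: Const_def X_power Y_power mult_single zero_prod_def)

lemma monomial_conv: "X ^ i * Y ^ j = Poly_Mapping.single (i, j) (1 :: 'k::comm_ring_1)"
  by (simp add: X_power Y_power mult_single)

lemma Const_0 [simp]: "Const 0 = (0 :: 'k::comm_ring_1 poly2)"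
  by (simp add: Const_def)

lemma Const_1 [simp]: "Const 1 = (1 :: 'k::comm_ring_1 poly2)"
  by (simp add: Const_def)

lemma Const_add: "Const (q + r) = Const q + (Const r :: 'k::comm_ring_1 poly2)"
  by (simp add: Const_def single_add)

lemma Const_mult: "Const (q * r) = Const q * (Const r :: 'k::comm_ring_1 poly2)"
  by (simp add: Const_def mult_single)

lemma Const_of_nat: "Const (of_nat n) = (of_nat n :: 'k::comm_ring_1 poly2)"
  by (induction n) (simp_all add: Const_add)

lemma Const_power: "Const (q ^ n) = (Const q ^ n :: 'k::comm_ring_1 poly2)"
  by (induction n) (simp_all add: Const_mult)

lemma Const_minus: "Const (- q) = - (Const q :: 'k::comm_ring_1 poly2)"
  by (simp add: Const_def single_uminus)

section \<open>Generated ideals\<close>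

lemma ideal_gen_base: "p \<in> S \<Longrightarrow> p \<in> ideal_gen S"
  unfolding ideal_gen_def by (rule module.span_base[OF module_times])

lemma ideal_gen_zero: "0 \<in> ideal_gen S"
  unfolding ideal_gen_def by (rule module.span_zero[OF module_times])

lemma ideal_gen_add: "p \<in> ideal_gen S \<Longrightarrow> q \<in> ideal_gen S \<Longrightarrow> p + q \<in> ideal_gen S"
  unfolding ideal_gen_def by (rule module.span_add[OF module_times])

lemma ideal_gen_diff: "p \<in> ideal_gen S \<Longrightarrow> q \<in> ideal_gen S \<Longrightarrow> p - q \<in> ideal_gen S"
  unfolding ideal_gen_def by (rule module.span_diff[OF module_times])

lemma ideal_gen_mult: "p \<in> ideal_gen S \<Longrightarrow> q * p \<in> ideal_gen S"
  unfolding ideal_gen_def by (rule module.span_scale[OF module_times])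

lemma ideal_gen_sum: "(\<And>x. x \<in> A \<Longrightarrow> g x \<in> ideal_gen S) \<Longrightarrow> sum g A \<in> ideal_gen S"
  unfolding ideal_gen_def by (rule module.span_sum[OF module_times])

lemma ideal_gen_subset: "S \<subseteq> ideal_gen T \<Longrightarrow> ideal_gen S \<subseteq> ideal_gen T"
  unfolding ideal_gen_def
  by (rule module.span_minimal[OF module_times _ module.subspace_span[OF module_times]])

lemma ideal_gen_dvd:
  assumes "q \<in> S" "q dvd p"
  shows "p \<in> ideal_gen S"
  using assms ideal_gen_mult[OF ideal_gen_base[OF assms(1)]] by (metis dvd_def mult.commute)

lemma ideal_gen_tripleE:
  assumes "g \<in> ideal_gen {p, q, r}"
  obtains A B D where "g = A * p + B * q + D * r"
proof -
  have "\<exists>A B D. g - A * p - B * q - D * r = 0"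
    using assms unfolding ideal_gen_def module.span_insert[OF module_times]
      module.span_empty[OF module_times] by auto
  then show ?thesis
    using that by (metis add.assoc diff_diff_eq eq_iff_diff_eq_0)
qed

text \<open>Used to carry the ideal of \<open>X^m\<close> and \<open>(X + Y)^C\<close> into
  \<open>I\<close> by the factor \<open>X^(aK) * Y^(bK)\<close>; it suffices to check the
  generators.\<close>

lemma ideal_gen_times_image:
  assumes "g \<in> ideal_gen S" "(*) w ` S \<subseteq> ideal_gen T"
  shows "w * g \<in> ideal_gen T"
  using assms(1) unfolding ideal_gen_def[of S]
proof (induction rule: module.span_induct_alt[OF module_times, consumes 1])
  case 1
  then show ?case by (simp add: ideal_gen_zero)
next
  case (2 c x y)
  have "w * (c * x + y) = c * (w * x) + w * y"
    by (simp add: algebra_simps)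
  moreover have "w * x \<in> ideal_gen T"
    using 2(1) assms(2) by blast
  ultimately show ?case
    using 2(2) by (simp add: ideal_gen_add ideal_gen_mult)
qed

section \<open>Homogeneous forms and elements with a coefficient gap\<close>

text \<open>This is \<open>V^d * P(U/V)\<close> for \<open>P\<close> of degree at most
  \<open>d\<close>. The variables \<open>U\<close>, \<open>V\<close> stay arbitrary because both the
  pair \<open>X\<close>, \<open>Y\<close> and the pair \<open>X + Y\<close>, \<open>- Y\<close> are
  needed.\<close>

definition homogenize :: "'k::comm_ring_1 poly2 \<Rightarrow> 'k poly2 \<Rightarrow> nat \<Rightarrow> 'k poly \<Rightarrow> 'k poly2"
  where "homogenize U V d P = (\<Sum>j\<le>d. Const (coeff P j) * U ^ j * V ^ (d - j))"

lemma homogenize_add: "homogenize U V d (P + Q) = homogenize U V d P + homogenize U V d Q"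
  by (simp add: homogenize_def Const_add algebra_simps sum.distrib)

lemma homogenize_pCons_0: "homogenize U V (Suc d) (pCons 0 P) = U * homogenize U V d P"
  by (simp add: homogenize_def sum.atMost_Suc_shift sum_distrib_left mult_ac del: sum.atMost_Suc)

lemma homogenize_Suc: "degree P \<le> d \<Longrightarrow> homogenize U V (Suc d) P = V * homogenize U V d P"
  by (simp add: homogenize_def coeff_eq_0 sum_distrib_left Suc_diff_le mult_ac)

text \<open>Multiplying \<open>P\<close> by its variable contributes \<open>U\<close>, and raising
  the formal degree contributes \<open>V\<close>; hence each factor \<open>1 + x\<close> turns into
  \<open>U + V\<close>.\<close>

lemma homogenize_linear_power_times:
  assumes "degree R \<le> d"
  shows "homogenize U V (C + d) ([:1, 1:] ^ C * R) = (U + V) ^ C * homogenize U V d R"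
proof (induction C)
  case (Suc C)
  let ?P = "[:1, 1:] ^ C * R"
  have "degree ?P \<le> C + d"
    using assms degree_mult_le[of "[:1, 1:] ^ C" R] degree_power_le[of "[:1, 1 :: 'a:]" C] by simp
  moreover have "[:1, 1:] ^ Suc C * R = pCons 0 ?P + ?P"
    by (simp add: distrib_right add.commute)
  ultimately show ?case
    using Suc by (simp only: homogenize_add homogenize_pCons_0 homogenize_Suc add_Suc)
      (simp add: algebra_simps)
qed simp

lemma prod_of_nat_diff_eq_0:
  assumes "k < m" "m - t \<le> k"
  shows "(\<Prod>l = 1..t. of_nat m - of_nat l - of_nat k) = (0 :: 'k::comm_ring_1)"
proof (rule prod_zero)
  show "\<exists>l\<in>{1..t}. of_nat m - of_nat l - of_nat k = (0 :: 'k)"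
    by (rule bexI[of _ "m - k"]) (use assms in \<open>auto simp: of_nat_diff\<close>)
qed simp

text \<open>
  The operator maps \<open>(1 + x)^(C + t)\<close> into the ideal of \<open>(1 + x)^C\<close> and cancels the coefficients
  in positions \<open>m - t, \<dots>, m - 1\<close>.
\<close>

lemma gap_element_in_ideal:
  fixes U V :: "'k::field poly2"
  assumes char: "CHAR('k) = 0 \<or> m \<le> CHAR('k)" and t: "t < m"
  shows "(\<Sum>j = 0..m - t - 1.
      Const ((\<Prod>l = 1..t. of_nat (m - j - l) / of_nat (m - l)) * of_nat ((C + t) choose j))
        * U ^ j * V ^ (C + t - j)) \<in> ideal_gen {U ^ m, (U + V) ^ C}"
proof -
  define P where "P = gap_operator m t ([:1, 1 :: 'k:] ^ (C + t))"
  \<comment> \<open>\<open>u\<close> is the common denominator of the target coefficients and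
    \<open>w j\<close> the numerator. It is a unit, so membership can be shown for the numerators
    first.\<close>
  define u where "u = (\<Prod>l = 1..t. of_nat (m - l) :: 'k)"
  define w where "w j = (\<Prod>l = 1..t. of_nat (m - j - l) :: 'k) * of_nat ((C + t) choose j)" for j
  have "of_nat (m - l) \<noteq> (0 :: 'k)" if "l \<in> {1..t}" for l
    by (rule of_nat_neq_0_of_less_CHAR) (use char t that in auto)
  then have "u \<noteq> 0"
    by (simp add: u_def del: of_nat_diff)
  have coeff_P: "coeff P j = (\<Prod>l = 1..t. of_nat m - of_nat l - of_nat j) * of_nat ((C + t) choose j)" for j
  proof -
    have "degree ([:1, 1 :: 'k:] ^ (C + t)) = C + t"
      by (simp add: degree_power_eq)
    then have "coeff ([:1, 1 :: 'k:] ^ (C + t)) j = of_nat ((C + t) choose j)"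
      by (cases "j \<le> C + t") (simp_all add: coeff_linear_poly_power coeff_eq_0 binomial_eq_0)
    then show ?thesis
      by (simp add: P_def coeff_gap_operator)
  qed
  \<comment> \<open>Below the gap, \<open>j + l < m\<close>, so subtraction in the naturals agrees
    with subtraction in the field.\<close>
  have low: "coeff P j = w j" if "j \<le> m - t - 1" for j
    unfolding coeff_P w_def
    by (intro arg_cong2[where f = "(*)"] prod.cong) (use that t in \<open>auto simp: of_nat_diff\<close>)
  obtain R where R: "P = [:1, 1:] ^ C * R"
    using linear_power_dvd_gap_operator[of C t "[:1, 1:] ^ (C + t)" m] by (auto simp: P_def elim: dvdE)
  have "degree P \<le> C + t"
    by (rule degree_le) (simp add: coeff_P binomial_eq_0)
  moreover have "degree P = C + degree R" if "R \<noteq> 0"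
    unfolding R by (subst degree_mult_eq) (use that in \<open>simp_all add: degree_power_eq\<close>)
  ultimately have "degree R \<le> t"
    by (cases "R = 0") simp_all
  then have "homogenize U V (C + t) P = (U + V) ^ C * homogenize U V t R"
    unfolding R by (rule homogenize_linear_power_times)
  then have hom: "homogenize U V (C + t) P \<in> ideal_gen {U ^ m, (U + V) ^ C}"
    by (auto intro: ideal_gen_dvd[of "(U + V) ^ C"])
  let ?term = "\<lambda>j. Const (coeff P j) * U ^ j * V ^ (C + t - j)"
  \<comment> \<open>The range is padded with zero terms up to at least \<open>m\<close>, so that it
    can be cut at \<open>m - t\<close> even when \<open>m\<close> exceeds
    \<open>C + t\<close>.\<close>
  have "homogenize U V (C + t) P = sum ?term {..max (C + t) m}"
    unfolding homogenize_def by (rule sum.mono_neutral_left) (auto simp: coeff_P binomial_eq_0)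
  also have "\<dots> = sum ?term {0..m - t - 1} + sum ?term {m - t..max (C + t) m}"
  proof -
    have "{..max (C + t) m} = {0..m - t - 1} \<union> {m - t..max (C + t) m}"
      using t by auto
    then show ?thesis
      using t by (simp add: sum.union_disjoint)
  qed
  finally have split: "sum ?term {0..m - t - 1} =
      homogenize U V (C + t) P - sum ?term {m - t..max (C + t) m}"
    by simp
  \<comment> \<open>Terms from \<open>m - t\<close> to \<open>m - 1\<close> lie in the gap and
    vanish; later ones are multiples of \<open>U^m\<close>.\<close>
  have "?term j \<in> ideal_gen {U ^ m, (U + V) ^ C}" if "m - t \<le> j" for j
  proof (cases "j < m")
    case True
    then have "coeff P j = 0"
      unfolding coeff_P by (simp only: prod_of_nat_diff_eq_0[OF True that] mult_zero_left)
    then show ?thesis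
      by (simp add: ideal_gen_zero)
  next
    case False
    then have "U ^ m dvd U ^ j"
      by (simp add: le_imp_power_dvd)
    then show ?thesis
      by (auto intro!: ideal_gen_dvd[of "U ^ m"] intro: dvd_mult dvd_mult2)
  qed
  then have "sum ?term {0..m - t - 1} \<in> ideal_gen {U ^ m, (U + V) ^ C}"
    unfolding split by (intro ideal_gen_diff hom ideal_gen_sum) simp
  then have "Const (inverse u) * sum ?term {0..m - t - 1} \<in> ideal_gen {U ^ m, (U + V) ^ C}"
    by (rule ideal_gen_mult)
  moreover have "Const (inverse u) * sum ?term {0..m - t - 1} = (\<Sum>j = 0..m - t - 1.
      Const ((\<Prod>l = 1..t. of_nat (m - j - l) / of_nat (m - l)) * of_nat ((C + t) choose j))
        * U ^ j * V ^ (C + t - j))"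
    unfolding sum_distrib_left
  proof (rule sum.cong)
    fix j assume "j \<in> {0..m - t - 1}"
    then have "inverse u * coeff P j =
        (\<Prod>l = 1..t. of_nat (m - j - l) / of_nat (m - l)) * of_nat ((C + t) choose j)"
      unfolding prod_dividef by (simp add: low w_def u_def divide_inverse mult_ac del: of_nat_diff)
    then show "Const (inverse u) * ?term j =
        Const ((\<Prod>l = 1..t. of_nat (m - j - l) / of_nat (m - l)) * of_nat ((C + t) choose j))
          * U ^ j * V ^ (C + t - j)"
      by (simp only: flip: Const_mult mult.assoc)
  qed simp
  ultimately show ?thesis
    by simp
qed

section \<open>Leading monomials and a criterion for Groebner bases\<close>

context
  fixes le :: "nat \<times> nat \<Rightarrow> nat \<times> nat \<Rightarrow> bool"
  assumes order: "monomial_order le"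
begin

interpretation monomial: linorder le "\<lambda>u v. le u v \<and> \<not> le v u"
  using order by (simp add: monomial_order_def)

lemma lead_monomial_eqI:
  assumes "m \<in> Poly_Mapping.keys p" "\<And>n. n \<in> Poly_Mapping.keys p \<Longrightarrow> le n m"
  shows "lead_monomial le p = m"
  unfolding lead_monomial_def using assms by (intro the_equality) (auto intro: monomial.order.antisym)

lemma lead_monomial_greatest:
  assumes "p \<noteq> 0"
  shows "lead_monomial le p \<in> Poly_Mapping.keys p"
    and "n \<in> Poly_Mapping.keys p \<Longrightarrow> le n (lead_monomial le p)"
proof -
  have "\<exists>m\<in>A. \<forall>n\<in>A. le n m" if "finite A" "A \<noteq> {}" for A
    using that
  proof (induction A rule: finite_ne_induct)
    case (insert x A)
    then obtain m where "m \<in> A" "\<forall>n\<in>A. le n m"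
      by blast
    then show ?case
      using monomial.linear[of x m] monomial.order_trans[of _ m x] by auto
  qed simp
  then obtain m where "m \<in> Poly_Mapping.keys p" "\<forall>n\<in>Poly_Mapping.keys p. le n m"
    using assms by (metis finite_keys keys_eq_empty)
  then have "lead_monomial le p \<in> Poly_Mapping.keys p \<and> (\<forall>n\<in>Poly_Mapping.keys p. le n (lead_monomial le p))"
    using lead_monomial_eqI[of m p] by auto
  then show "lead_monomial le p \<in> Poly_Mapping.keys p"
    and "n \<in> Poly_Mapping.keys p \<Longrightarrow> le n (lead_monomial le p)"
    by auto
qed

text \<open>Three inclusions form a cycle: the leading terms of \<open>G\<close> lie in the initial
  ideal, which by \<open>divides\<close> lies in the monomial ideal of \<open>S\<close>, which
  returns to the leading terms of \<open>G\<close> because leading coefficients over a field are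
  invertible.\<close>

lemma groebner_basis_of_lead_monomials:
  fixes G I :: "'k::field poly2 set"
  assumes "finite G" "G \<subseteq> I"
    and lead: "lead_monomial le ` G = S" "0 \<notin> G"
    and divides: "\<And>g i j. g \<in> I \<Longrightarrow> g \<noteq> 0 \<Longrightarrow> lead_monomial le g = (i, j) \<Longrightarrow>
      \<exists>(k, l)\<in>S. k \<le> i \<and> l \<le> j"
  shows "groebner_basis le G I \<and> init_ideal le I = ideal_gen ((\<lambda>m. Poly_Mapping.single m 1) ` S)"
proof -
  let ?T = "(\<lambda>m. Poly_Mapping.single m (1 :: 'k)) ` S"
  have 1: "ideal_gen (lead_term le ` G) \<subseteq> init_ideal le I"
    unfolding init_ideal_def using \<open>G \<subseteq> I\<close> by (intro ideal_gen_subset) (auto intro: ideal_gen_base)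
  have 2: "init_ideal le I \<subseteq> ideal_gen ?T"
    unfolding init_ideal_def
  proof (rule ideal_gen_subset, safe)
    fix g assume "g \<in> I"
    show "lead_term le g \<in> ideal_gen ?T"
    proof (cases "g = 0")
      case True
      then show ?thesis
        by (simp add: lead_term_def ideal_gen_zero)
    next
      case False
      obtain i j where ij: "lead_monomial le g = (i, j)"
        by fastforce
      obtain k l where kl: "(k, l) \<in> S" "k \<le> i" "l \<le> j"
        using divides[OF \<open>g \<in> I\<close> False ij] by auto
      have "lead_term le g = Poly_Mapping.single (i - k, j - l) (Poly_Mapping.lookup g (i, j)) * Poly_Mapping.single (k, l) 1"
        using kl by (simp add: lead_term_def ij mult_single)
      moreover have "Poly_Mapping.single (k, l) 1 \<in> ideal_gen ?T"
        using kl(1) by (auto intro: ideal_gen_base)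
      ultimately show ?thesis
        by (simp only: ideal_gen_mult)
    qed
  qed
  have 3: "ideal_gen ?T \<subseteq> ideal_gen (lead_term le ` G)"
  proof (rule ideal_gen_subset, safe)
    fix m assume "m \<in> S"
    then obtain h where h: "h \<in> G" "lead_monomial le h = m"
      using lead(1) by auto
    then have "Poly_Mapping.lookup h m \<noteq> 0"
      using lead_monomial_greatest(1)[of h] lead(2) by (auto simp: in_keys_iff)
    then have "Poly_Mapping.single m 1 = Const (inverse (Poly_Mapping.lookup h m)) * lead_term le h"
      by (simp add: lead_term_def h Const_def mult_single)
    moreover have "lead_term le h \<in> ideal_gen (lead_term le ` G)"
      using h(1) by (auto intro: ideal_gen_base)
    ultimately show "Poly_Mapping.single m 1 \<in> ideal_gen (lead_term le ` G)"
      by (simp only: ideal_gen_mult)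
  qed
  show ?thesis
    using 1 2 3 assms(1,2) unfolding groebner_basis_def by blast
qed

context
  assumes x_gt_y: "le (0, 1) (1, 0)"
begin

text \<open>Trading one factor \<open>y\<close> for \<open>x\<close> moves up in the order. Thus all
  orders with \<open>x > y\<close> agree within one total degree, which is why the choice of order
  does not affect the result.\<close>

lemma le_of_same_degree:
  assumes "i + j = k + l" "i \<le> k"
  shows "le (i, j) (k, l)"
proof -
  have step: "le (i, Suc j) (Suc i, j)" for i j
  proof -
    have "le ((0, 1) + (i, j)) ((1, 0) + (i, j))"
      using order x_gt_y unfolding monomial_order_def by blast
    then show ?thesis
      by simp
  qed
  have "le (i, n + j) (i + n, j)" for n i j
  proof (induction n arbitrary: j)
    case (Suc n)
    show ?case
      using monomial.order_trans[OF Suc.IH[of "Suc j"] step[of "i + n" j]] by simp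
  qed simp
  moreover have "k - i + l = j"
    using assms by simp
  ultimately show ?thesis
    using assms(2) by (metis le_add_diff_inverse)
qed

text \<open>All terms have total degree \<open>r + s + d\<close>, so the largest power of
  \<open>x\<close> leads. Allowing \<open>n < d\<close> covers the truncated forms
  \<open>polyH\<close> and \<open>polyL\<close>.\<close>

lemma lead_monomial_sum_single:
  fixes q :: "nat \<Rightarrow> 'k::comm_ring_1"
  assumes "q n \<noteq> 0" "n \<le> d"
  shows "lead_monomial le (\<Sum>i\<le>n. Poly_Mapping.single (r + i, s + (d - i)) (q i)) = (r + n, s + (d - n))"
    and "(\<Sum>i\<le>n. Poly_Mapping.single (r + i, s + (d - i)) (q i)) \<noteq> 0"
proof -
  let ?p = "\<Sum>i\<le>n. Poly_Mapping.single (r + i, s + (d - i)) (q i)"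
  have "Poly_Mapping.lookup ?p (r + n, s + (d - n)) = (\<Sum>i\<le>n. if i = n then q i else 0)"
    unfolding lookup_sum by (rule sum.cong) (auto simp: lookup_single)
  then have top: "(r + n, s + (d - n)) \<in> Poly_Mapping.keys ?p"
    using assms(1) by (simp add: in_keys_iff)
  then show "?p \<noteq> 0"
    by (metis keys_zero empty_iff)
  show "lead_monomial le ?p = (r + n, s + (d - n))"
  proof (rule lead_monomial_eqI[OF top])
    fix m assume "m \<in> Poly_Mapping.keys ?p"
    then obtain i where "i \<le> n" "m = (r + i, s + (d - i))"
      using keys_sum[of "\<lambda>i. Poly_Mapping.single (r + i, s + (d - i)) (q i)" "{..n}"]
      by (auto split: if_splits)
    then show "le m (r + n, s + (d - n))"
      using assms(2) by (auto intro!: le_of_same_degree)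
  qed
qed

end

end

section \<open>Passing to one variable, and the bound on leading monomials of the ideal\<close>

text \<open>The homogeneous component of degree \<open>d\<close>, evaluated at
  \<open>y = 1\<close>.\<close>

definition dehomogenize :: "nat \<Rightarrow> 'k::comm_ring_1 poly2 \<Rightarrow> 'k poly"
  where "dehomogenize d p = (\<Sum>k\<le>d. monom (Poly_Mapping.lookup p (k, d - k)) k)"

lemma coeff_dehomogenize:
  "coeff (dehomogenize d p) k = (if k \<le> d then Poly_Mapping.lookup p (k, d - k) else 0)"
  by (simp add: dehomogenize_def coeff_sum)

lemma degree_dehomogenize: "degree (dehomogenize d p) \<le> d"
  by (rule degree_le) (simp add: coeff_dehomogenize)

lemma dehomogenize_add: "dehomogenize d (p + q) = dehomogenize d p + dehomogenize d q"
  by (rule poly_eqI) (simp add: coeff_dehomogenize lookup_add)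

lemma dehomogenize_times_X: "dehomogenize (Suc d) (p * X) = pCons 0 (dehomogenize d p)"
  by (rule poly_eqI)
    (auto simp: X_def coeff_dehomogenize lookup_times_single coeff_pCons split: nat.split)

lemma dehomogenize_times_Y: "dehomogenize (Suc d) (p * Y) = dehomogenize d p"
  by (rule poly_eqI)
    (auto simp: Y_def coeff_dehomogenize lookup_times_single Suc_diff_le)

lemma dehomogenize_0: "dehomogenize 0 (p * X) = 0" "dehomogenize 0 (p * Y) = 0"
  by (rule poly_eqI, simp add: X_def Y_def coeff_dehomogenize lookup_times_single)+

text \<open>\<open>u\<close> is the linear form \<open>w\<close> at \<open>y = 1\<close>, and each
  factor \<open>w\<close> lowers the relevant degree of the cofactor by one. The disjunction lets
  one induction serve all three forms.\<close>

lemma dehomogenize_times_power: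
  assumes "w = X \<and> u = [:0, 1:] \<or> w = Y \<and> u = 1 \<or> w = X + Y \<and> u = [:1, 1:]"
  shows "dehomogenize d (p * w ^ n) = (if d < n then 0 else dehomogenize (d - n) p * u ^ n)"
proof (induction n arbitrary: d)
  case (Suc n)
  have *: "p * w ^ Suc n = p * w ^ n * w"
    by (simp add: mult_ac)
  show ?case
  proof (cases d)
    case 0
    then show ?thesis
      unfolding * using assms by (auto simp: dehomogenize_0 distrib_left dehomogenize_add)
  next
    case (Suc d')
    have "dehomogenize (Suc d') (p * w ^ n * w) = dehomogenize d' (p * w ^ n) * u"
      using assms by (auto simp: dehomogenize_times_X dehomogenize_times_Y distrib_left dehomogenize_add)
    then show ?thesis
      unfolding * using Suc Suc.IH[of d'] by (simp add: mult_ac del: mult_pCons_left mult_pCons_right)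
  qed
qed simp

lemma dehomogenize_times_X_Y_XY:
  "dehomogenize d (p * (X ^ r * Y ^ s * (X + Y) ^ C)) =
    (if d < r + s + C then 0
     else monom 1 r * (dehomogenize (d - (r + s + C)) p * [:1, 1:] ^ C))"
proof -
  have "p * (X ^ r * Y ^ s * (X + Y) ^ C) = p * X ^ r * Y ^ s * (X + Y) ^ C"
    by (simp only: mult.assoc)
  also have "dehomogenize d \<dots> =
      (if d < C then 0 else dehomogenize (d - C) (p * X ^ r * Y ^ s) * [:1, 1:] ^ C)"
    by (rule dehomogenize_times_power) simp
  also have "dehomogenize (d - C) (p * X ^ r * Y ^ s) =
      (if d - C < s then 0 else dehomogenize (d - C - s) (p * X ^ r) * 1 ^ s)"
    by (rule dehomogenize_times_power) simp
  also have "dehomogenize (d - C - s) (p * X ^ r) =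
      (if d - C - s < r then 0 else dehomogenize (d - C - s - r) p * [:0, 1:] ^ r)"
    by (rule dehomogenize_times_power) simp
  also have "d - C - s - r = d - (r + s + C)"
    by simp
  finally show ?thesis
    by (auto simp only: monom_altdef smult_1_left mult_ac power_one mult_1_right mult_1_left mult_zero_left split: if_splits)
qed

text \<open>Maximality of the leading monomial within its degree forces a gap in the coefficients of
  a multiple of \<open>(1 + x)^C\<close>, running from just after \<open>i - r\<close> up to
  \<open>m\<close>. By \<open>no_coefficient_gap\<close> the cofactor needs enough degree, which
  bounds \<open>j\<close> from below.\<close>

lemma lead_monomial_cases:
  fixes g :: "'k::field poly2"
  assumes order: "monomial_order le" and x_gt_y: "le (0, 1) (1, 0)"
    and char: "CHAR('k) = 0 \<or> m + C \<le> CHAR('k)"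
    and g: "g \<in> ideal_gen {X ^ (r + m), Y ^ N, X ^ r * Y ^ s * (X + Y) ^ C}" "g \<noteq> 0"
    and lead: "lead_monomial le g = (i, j)"
    and "i < r + m" "j < N"
  shows "r \<le> i \<and> s \<le> j \<and> (r + C \<le> i \<or> m + C \<le> 2 * (i - r) + 1 + (j - s))"
proof -
  interpret monomial: linorder le "\<lambda>u v. le u v \<and> \<not> le v u"
    using order by (simp add: monomial_order_def)
  let ?f = "X ^ r * Y ^ s * (X + Y) ^ C :: 'k poly2"
  obtain A B D where "g = A * X ^ (r + m) + B * Y ^ N + D * ?f"
    using g(1) by (rule ideal_gen_tripleE)
  \<comment> \<open>Multiples of the two pure powers contribute nothing to these exponents.\<close>
  then have lookup_g: "Poly_Mapping.lookup g (k, l) = Poly_Mapping.lookup (D * ?f) (k, l)"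
    if "k < r + m" "l < N" for k l
    using that by (simp add: lookup_add X_power[of "r + m"] Y_power[of N] lookup_times_single)
  have key: "Poly_Mapping.lookup g (i, j) \<noteq> 0"
    using lead_monomial_greatest(1)[OF order g(2)] lead by (simp add: in_keys_iff)
  have max: "le n (i, j)" if "n \<in> Poly_Mapping.keys g" for n
    using lead_monomial_greatest(2)[OF order g(2) that] lead by simp
  define F where "F = dehomogenize (i + j) (D * ?f)"
  have F_i: "coeff F i \<noteq> 0"
    using key lookup_g[OF assms(7,8)] by (simp add: F_def coeff_dehomogenize)
  \<comment> \<open>A nonzero coefficient here would give a monomial of \<open>g\<close> of the same
    total degree with more \<open>x\<close>; its \<open>y\<close> exponent is below
    \<open>j\<close>, hence below \<open>N\<close>.\<close>
  have F_gap: "coeff F k = 0" if "i < k" "k < r + m" for k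
  proof (rule ccontr)
    assume nz: "coeff F k \<noteq> 0"
    then have "k \<le> i + j"
      by (auto simp: F_def coeff_dehomogenize split: if_splits)
    then have "(k, i + j - k) \<in> Poly_Mapping.keys g"
      using nz that \<open>j < N\<close> lookup_g[of k "i + j - k"] by (simp add: F_def coeff_dehomogenize in_keys_iff)
    from max[OF this] have "le (k, i + j - k) (i, j)" .
    moreover have "le (i, j) (k, i + j - k)"
      using that \<open>k \<le> i + j\<close> by (intro le_of_same_degree[OF order x_gt_y]) auto
    ultimately show False
      using that(1) monomial.order.antisym by fastforce
  qed
  define e where "e = i + j - (r + s + C)"
  define E where "E = dehomogenize e D"
  have F: "F = monom 1 r * (E * [:1, 1:] ^ C)" and d: "r + s + C \<le> i + j"
    using F_i dehomogenize_times_X_Y_XY[of "i + j" D r s C]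
    by (auto simp: F_def E_def e_def split: if_splits)
  have "r \<le> i"
    using F_i by (auto simp: F coeff_monom_mult split: if_splits)
  have E_i: "coeff (E * [:1, 1:] ^ C) (i - r) \<noteq> 0"
    using F_i \<open>r \<le> i\<close> by (simp add: F coeff_monom_mult)
  have E_gap: "coeff (E * [:1, 1:] ^ C) k = 0" if "Suc (i - r) \<le> k" "k < m" for k
    using F_gap[of "r + k"] that by (simp add: F coeff_monom_mult)
  have "degree E \<le> e"
    by (simp add: E_def degree_dehomogenize)
  \<comment> \<open>Together with \<open>degree E\<close> \<le>
    \<open>e = i + j - (r + s + C)\<close> this yields \<open>s\<close> \<le>
    \<open>j\<close>.\<close>
  moreover have "i - r \<le> degree E + C"
    using le_degree[OF E_i] degree_mult_le[of E "[:1, 1:] ^ C"] degree_power_le[of "[:1, 1 :: 'k:]" C]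
    by simp
  ultimately have "s \<le> j"
    using d \<open>r \<le> i\<close> by (simp add: e_def)
  \<comment> \<open>The negation says exactly that \<open>e < m - (i - r + 1)\<close>, so the gap is
    longer than the degree of \<open>E\<close>. The assumption \<open>i < r + C\<close> lets the gap
    start at \<open>i - r + 1\<close> \<le> \<open>C\<close>.\<close>
  have "m + C \<le> 2 * (i - r) + 1 + (j - s)" if "i < r + C"
  proof (rule ccontr)
    assume "\<not> ?thesis"
    then have "degree E < m - Suc (i - r)"
      using \<open>degree E \<le> e\<close> d \<open>r \<le> i\<close> \<open>s \<le> j\<close> by (simp add: e_def)
    then have "E = 0"
      using that \<open>r \<le> i\<close> char
      by (intro no_coefficient_gap[of E m "Suc (i - r)" C] E_gap) (auto simp: add.commute)
    with E_i show False
      by simp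
  qed
  with \<open>r \<le> i\<close> \<open>s \<le> j\<close> show ?thesis
    by linarith
qed

section \<open>Leading monomials of the explicit generators\<close>

lemma lead_monomial_X_power: "monomial_order le \<Longrightarrow> lead_monomial le (X ^ i :: 'k::field poly2) = (i, 0)"
  by (rule lead_monomial_eqI) (auto simp: X_power monomial_order_def class.linorder_def
      class.order_def class.preorder_def)

lemma lead_monomial_Y_power: "monomial_order le \<Longrightarrow> lead_monomial le (Y ^ j :: 'k::field poly2) = (0, j)"
  by (rule lead_monomial_eqI) (auto simp: Y_power monomial_order_def class.linorder_def
      class.order_def class.preorder_def)

lemma Setcompr_less_eq_image: "{h t | t. t < (n :: nat)} = h ` {..<n}"
  by auto

lemma X_power_neq_0: "X ^ i \<noteq> (0 :: 'k::field poly2)"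
  and Y_power_neq_0: "Y ^ j \<noteq> (0 :: 'k::field poly2)"
  by (simp_all add: X_power Y_power poly_mapping_eq_iff fun_eq_iff lookup_single when_def)

lemma X_Y_XY_conv:
  "X ^ r * Y ^ s * (X + Y) ^ C =
    (\<Sum>i\<le>C. Poly_Mapping.single (r + i, s + (C - i)) (of_nat (C choose i) :: 'k::field))"
proof -
  have "X ^ r * Y ^ s * (of_nat (C choose i) * X ^ i * Y ^ (C - i)) =
      Poly_Mapping.single (r + i, s + (C - i)) (of_nat (C choose i) :: 'k)" for i
    by (simp add: power_add mult_ac Const_of_nat flip: Const_times_monomial)
  then show ?thesis
    by (simp add: binomial_ring sum_distrib_left)
qed

text \<open>The cofactor is the gap element for \<open>U = X\<close> and
  \<open>V = Y\<close>.\<close>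

lemma polyH_factor:
  assumes "M - a * K \<le> c * K" "t < M - a * K"
  shows "polyH M K a b c t = X ^ (a * K) * Y ^ (b * K) * (\<Sum>j = 0..M - a * K - t - 1.
      Const ((\<Prod>l = 1..t. of_nat (M - a * K - j - l) / of_nat (M - a * K - l))
        * of_nat ((c * K + t) choose j)) * X ^ j * Y ^ (c * K + t - j))"
  unfolding polyH_def sum_distrib_left
proof (rule sum.cong)
  fix j assume "j \<in> {0..M - a * K - t - 1}"
  then have "(b + c) * K - j + t = b * K + (c * K + t - j)"
    using assms by (simp add: add_mult_distrib)
  then show "Const ((\<Prod>l = 1..t. of_nat (M - a * K - j - l) / of_nat (M - a * K - l))
        * of_nat ((c * K + t) choose j)) * X ^ (a * K + j) * Y ^ ((b + c) * K - j + t) =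
      X ^ (a * K) * Y ^ (b * K) * (Const ((\<Prod>l = 1..t. of_nat (M - a * K - j - l) / of_nat (M - a * K - l))
        * of_nat ((c * K + t) choose j)) * X ^ j * Y ^ (c * K + t - j))"
    by (simp add: power_add mult_ac)
qed simp

lemma polyH_lead:
  assumes order: "monomial_order le" "le (0, 1) (1, 0)"
    and char: "CHAR('k::field) = 0 \<or> M - a * K + c * K \<le> CHAR('k)"
    and "M - a * K \<le> c * K" and t: "t < M - a * K"
  shows "lead_monomial le (polyH M K a b c t :: 'k poly2) =
      (M - t - 1, (a + b + c) * K - M + 2 * t + 1)"
    and "polyH M K a b c t \<noteq> (0 :: 'k poly2)"
proof -
  let ?m = "M - a * K"
  define q where "q j = (\<Prod>l = 1..t. of_nat (?m - j - l) / of_nat (?m - l))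
    * (of_nat ((c * K + t) choose j) :: 'k)" for j
  have H: "polyH M K a b c t =
      (\<Sum>j\<le>?m - t - 1. Poly_Mapping.single (a * K + j, b * K + (c * K + t - j)) (q j))"
    unfolding polyH_factor[OF assms(4,5)] sum_distrib_left q_def
    by (rule sum.cong) (auto simp: atMost_atLeast0 power_add mult_ac simp flip: Const_times_monomial)
  \<comment> \<open>At the last index the numerators multiply to \<open>t!\<close>. The binomial
    coefficient is a unit because \<open>c * K + t < ?m + c * K\<close>.\<close>
  have "q (?m - t - 1) \<noteq> 0"
  proof -
    have "of_nat (?m - (?m - t - 1) - l) / of_nat (?m - l) \<noteq> (0 :: 'k)" if "l \<in> {1..t}" for l
    proof -
      have "of_nat (?m - (?m - t - 1) - l) \<noteq> (0 :: 'k)" "of_nat (?m - l) \<noteq> (0 :: 'k)"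
        by (rule of_nat_neq_0_of_less_CHAR; use char t that assms(4) in auto)+
      then show ?thesis
        by (simp del: of_nat_diff)
    qed
    moreover have "of_nat ((c * K + t) choose (?m - t - 1)) \<noteq> (0 :: 'k)"
      using char t assms(4) by (intro of_nat_choose_neq_0) auto
    ultimately show ?thesis
      by (simp add: q_def del: of_nat_diff)
  qed
  note lead = lead_monomial_sum_single[of le q, OF order this, of "c * K + t" "a * K" "b * K", folded H]
  show "polyH M K a b c t \<noteq> (0 :: 'k poly2)"
    using lead(2) assms(4) by simp
  have "a * K + (?m - t - 1) = M - t - 1"
    "b * K + (c * K + t - (?m - t - 1)) = (a + b + c) * K - M + 2 * t + 1"
    using t assms(4) by (auto simp: add_mult_distrib)
  then show "lead_monomial le (polyH M K a b c t :: 'k poly2) =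
      (M - t - 1, (a + b + c) * K - M + 2 * t + 1)"
    using lead(1) assms(4) by simp
qed

lemma polyL_conv:
  assumes "c * K \<le> M - a * K" "t < c * K" "a * K < M"
  shows "polyL M K a b c t = (\<Sum>i = 0..c * K - t - 1.
      Poly_Mapping.single (a * K + i, b * K + (M - a * K + t - i))
        (\<Sum>j = i..c * K - t - 1. (- 1) ^ (M - a * K + t - j)
           * (\<Prod>l = 1..t. of_nat (c * K - j - l) / of_nat (c * K - l))
           * of_nat ((M - a * K + t) choose j) * (of_nat (j choose i) :: 'k::field)))"
  unfolding polyL_def Const_times_monomial
proof (intro sum.cong arg_cong2[where f = Poly_Mapping.single])
  fix i assume i: "i \<in> {0..c * K - t - 1}"
  then show "(i + a * K, M + b * K - a * K - i + t) = (a * K + i, b * K + (M - a * K + t - i))"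
    using assms by auto
  fix j assume j: "j \<in> {i..c * K - t - 1}"
  \<comment> \<open>The two sign exponents differ by the even number \<open>2 * t\<close>.\<close>
  then have "M - a * K + t - j = M - a * K - j - t + 2 * t"
    using assms by auto
  then have "(- 1 :: 'k) ^ (M - a * K - j - t) = (- 1) ^ (M - a * K + t - j)"
    by (simp add: power_add power_mult)
  then show "(- 1) ^ (M - a * K - j - t)
      * ((\<Prod>l = 1..t. of_nat (c * K - j - l)) / (\<Prod>l = 1..t. of_nat (c * K - l)))
      * of_nat ((M - a * K + t) choose j) * of_nat (j choose i) =
    (- 1) ^ (M - a * K + t - j)
      * (\<Prod>l = 1..t. of_nat (c * K - j - l) / of_nat (c * K - l))
      * of_nat ((M - a * K + t) choose j) * (of_nat (j choose i) :: 'k)"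
    by (simp add: prod_dividef del: of_nat_diff)
qed (auto simp: diff_commute)

text \<open>
  In the variables \<open>X + Y\<close> and \<open>- Y\<close>, whose sum is \<open>X\<close>, the powers \<open>X^m\<close> and \<open>(X + Y)^C\<close> swap
  roles, which turns \<open>L\<^sub>t\<close> into an instance of \<open>H\<^sub>t\<close>.
\<close>

lemma polyL_factor:
  assumes "c * K \<le> M - a * K" "t < c * K" "a * K < M"
  shows "polyL M K a b c t = X ^ (a * K) * Y ^ (b * K) * (\<Sum>j = 0..c * K - t - 1.
      Const ((\<Prod>l = 1..t. of_nat (c * K - j - l) / of_nat (c * K - l))
        * of_nat ((M - a * K + t) choose j)) * (X + Y) ^ j
        * (- Y :: 'k::field poly2) ^ (M - a * K + t - j))" (is "_ = ?w * (\<Sum>j = 0..?n. ?g j)")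
proof -
  let ?d = "M - a * K + t"
  define u where "u j = (\<Prod>l = 1..t. of_nat (c * K - j - l) / of_nat (c * K - l))
    * (of_nat (?d choose j) :: 'k)" for j
  define h where "h j i = Poly_Mapping.single (a * K + i, b * K + (?d - i))
    ((- 1) ^ (?d - j) * u j * of_nat (j choose i))" for j i
  \<comment> \<open>The power of \<open>X + Y\<close> is expanded binomially. The index set is
    written as a filter of \<open>{0..?n}\<close> so that the order of summation over the triangle
    \<open>i\<close> \<le> \<open>j\<close> can be exchanged.\<close>
  have "?w * ?g j = (\<Sum>i \<in> {i. i \<in> {0..?n} \<and> i \<le> j}. h j i)" if "j \<in> {0..?n}" for j
  proof -
    have "?w * (Const (u j) * (of_nat (j choose i) * X ^ i * Y ^ (j - i)) * (- Y) ^ (?d - j)) = h j i"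
      if "i \<le> j" for i
    proof -
      have "?d - i = (j - i) + (?d - j)"
        using that \<open>j \<in> {0..?n}\<close> assms by auto
      moreover have "(- Y :: 'k poly2) ^ (?d - j) = Const ((- 1) ^ (?d - j)) * Y ^ (?d - j)"
        by (simp add: Const_power Const_minus flip: power_mult_distrib)
      ultimately show ?thesis
        unfolding h_def by (simp only: power_add Const_mult Const_of_nat mult_ac flip: Const_times_monomial)
    qed
    moreover have "{i. i \<in> {0..?n} \<and> i \<le> j} = {..j}"
      using that by auto
    ultimately show ?thesis
      by (simp add: binomial_ring sum_distrib_left sum_distrib_right u_def)
  qed
  then have "?w * (\<Sum>j = 0..?n. ?g j) = (\<Sum>j = 0..?n. \<Sum>i \<in> {i. i \<in> {0..?n} \<and> i \<le> j}. h j i)"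
    by (simp only: sum_distrib_left cong: sum.cong)
  also have "\<dots> = (\<Sum>i = 0..?n. \<Sum>j \<in> {j. j \<in> {0..?n} \<and> i \<le> j}. h j i)"
    by (rule sum.swap_restrict) simp_all
  also have "\<dots> = (\<Sum>i = 0..?n. \<Sum>j = i..?n. h j i)"
    by (intro sum.cong) auto
  also have "\<dots> = polyL M K a b c t"
    unfolding polyL_conv[OF assms] h_def u_def
  proof (rule sum.cong)
    have single_sum: "(\<Sum>j\<in>A. Poly_Mapping.single m (p j)) = Poly_Mapping.single m (\<Sum>j\<in>A. p j)"
      for A :: "nat set" and m and p :: "nat \<Rightarrow> 'k"
      by (induction A rule: infinite_finite_induct) (simp_all add: single_add)
    fix i
    show "(\<Sum>j = i..?n. Poly_Mapping.single (a * K + i, b * K + (?d - i)) ((- 1) ^ (?d - j)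
        * ((\<Prod>l = 1..t. of_nat (c * K - j - l) / of_nat (c * K - l)) * of_nat (?d choose j))
        * of_nat (j choose i))) =
      Poly_Mapping.single (a * K + i, b * K + (?d - i)) (\<Sum>j = i..?n. (- 1) ^ (?d - j)
        * (\<Prod>l = 1..t. of_nat (c * K - j - l) / of_nat (c * K - l)) * of_nat (?d choose j)
        * (of_nat (j choose i) :: 'k))"
      unfolding single_sum by (simp only: mult.assoc)
  qed simp
  finally show ?thesis
    by simp
qed

lemma polyL_lead:
  assumes order: "monomial_order le" "le (0, 1) (1, 0)"
    and char: "CHAR('k::field) = 0 \<or> M - a * K + c * K \<le> CHAR('k)"
    and "c * K \<le> M - a * K" and t: "t < c * K" and "a * K < M"
  shows "lead_monomial le (polyL M K a b c t :: 'k poly2) =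
      ((a + c) * K - t - 1, M + b * K - (a + c) * K + 2 * t + 1)"
    and "polyL M K a b c t \<noteq> (0 :: 'k poly2)"
proof -
  let ?d = "M - a * K + t" and ?n = "c * K - t - 1"
  define q where "q i = (\<Sum>j = i..?n. (- 1) ^ (?d - j)
           * (\<Prod>l = 1..t. of_nat (c * K - j - l) / of_nat (c * K - l))
           * of_nat (?d choose j) * (of_nat (j choose i) :: 'k))" for i
  have L: "polyL M K a b c t =
      (\<Sum>i\<le>?n. Poly_Mapping.single (a * K + i, b * K + (?d - i)) (q i))"
    unfolding polyL_conv[OF assms(4-6)] q_def atMost_atLeast0 ..
  \<comment> \<open>Only \<open>j = ?n\<close> remains in the inner sum, with numerators multiplying
    to \<open>t!\<close>.\<close>
  have "q ?n \<noteq> 0"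
  proof -
    have "of_nat (c * K - ?n - l) / of_nat (c * K - l) \<noteq> (0 :: 'k)" if "l \<in> {1..t}" for l
    proof -
      have "of_nat (c * K - ?n - l) \<noteq> (0 :: 'k)" "of_nat (c * K - l) \<noteq> (0 :: 'k)"
        by (rule of_nat_neq_0_of_less_CHAR; use char t that assms(4) in auto)+
      then show ?thesis
        by (simp del: of_nat_diff)
    qed
    moreover have "of_nat (?d choose ?n) \<noteq> (0 :: 'k)"
      using char t assms(4) by (intro of_nat_choose_neq_0) auto
    ultimately show ?thesis
      by (simp add: q_def del: of_nat_diff)
  qed
  note lead = lead_monomial_sum_single[of le q, OF order this, of ?d "a * K" "b * K", folded L]
  have n: "?n \<le> ?d"
    using assms(4) by simp
  from lead(2)[OF n] show "polyL M K a b c t \<noteq> (0 :: 'k poly2)" .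
  have "a * K + ?n = (a + c) * K - t - 1"
    "b * K + (?d - ?n) = M + b * K - (a + c) * K + 2 * t + 1"
    using t assms(4,6) by (auto simp: add_mult_distrib)
  with lead(1)[OF n] show "lead_monomial le (polyL M K a b c t :: 'k poly2) =
      ((a + c) * K - t - 1, M + b * K - (a + c) * K + 2 * t + 1)"
    by simp
qed

section \<open>The three cases for the ideal\<close>

theorem proposition4p2:
  fixes M N K a b c :: nat
    and f :: "'k::field poly2"
    and I :: "'k poly2 set"
    and le :: "nat \<times> nat \<Rightarrow> nat \<times> nat \<Rightarrow> bool"
  assumes char: "CHAR('k) = 0 \<or> int M + (int c - int a) * int K \<le> int CHAR('k)"
    and f: "f = X ^ a * Y ^ b * (X + Y) ^ c"
    and I: "I = ideal_gen {X ^ M, Y ^ N, f ^ K}"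
    and order: "monomial_order le"
    and x_gt_y: "le (0, 1) (1, 0)"
  shows "(a * K \<ge> M \<or> b * K \<ge> N \<longrightarrow> groebner_basis le {X ^ M, Y ^ N} I) \<and>
    (a * K < M \<and> b * K < N \<and> (a + c) * K \<ge> M \<longrightarrow>
      groebner_basis le ({X ^ M, Y ^ N} \<union> {polyH M K a b c t | t. t < M - a * K}) I \<and>
      init_ideal le I = ideal_gen ({X ^ M, Y ^ N} \<union>
        {X ^ (M - t - 1) * Y ^ ((a + b + c) * K - M + 2 * t + 1) | t. t < M - a * K})) \<and>
    (a * K < M \<and> b * K < N \<and> (a + c) * K < M \<longrightarrow>
      groebner_basis le
        ({X ^ M, Y ^ N, X ^ (a * K) * Y ^ (b * K) * (X + Y) ^ (c * K)}
          \<union> {polyL M K a b c t | t. t < c * K}) I \<and>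
      init_ideal le I = ideal_gen ({X ^ M, Y ^ N, X ^ ((a + c) * K) * Y ^ (b * K)} \<union>
        {X ^ ((a + c) * K - t - 1) * Y ^ (M + b * K - (a + c) * K + 2 * t + 1) | t. t < c * K}))"
proof (intro conjI impI; (elim conjE)?)
  let ?r = "a * K" and ?s = "b * K" and ?C = "c * K" and ?m = "M - a * K"
  have fK: "f ^ K = X ^ ?r * Y ^ ?s * (X + Y) ^ ?C"
    unfolding f by (simp only: power_mult_distrib power_mult)
  have char': "CHAR('k) = 0 \<or> ?m + ?C \<le> CHAR('k)" if "?r < M"
  proof -
    \<comment> \<open>The hypothesis is stated over the integers since \<open>c < a\<close> is
      possible; for \<open>a * K < M\<close> it becomes a bound on a sum of naturals.\<close>
    have "int M + (int c - int a) * int K = int (?m + ?C)"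
      using that by (simp add: algebra_simps of_nat_diff)
    then show ?thesis
      using char by (simp only: of_nat_le_iff)
  qed
  have gen: "X ^ M \<in> I" "Y ^ N \<in> I" "f ^ K \<in> I"
    unfolding I by (auto intro: ideal_gen_base)
  have mult_I: "X ^ ?r * Y ^ ?s * g \<in> I"
    if g: "g \<in> ideal_gen {X ^ ?m, (X + Y) ^ ?C}" and "?r < M" for g
  proof -
    have "X ^ ?r * Y ^ ?s * X ^ ?m = (Y ^ ?s * X ^ (?r + ?m) :: 'k poly2)"
      by (simp add: power_add mult_ac)
    then have "X ^ ?r * Y ^ ?s * X ^ ?m = (Y ^ ?s * X ^ M :: 'k poly2)"
      using \<open>?r < M\<close> by simp
    then have "X ^ ?r * Y ^ ?s * X ^ ?m \<in> I"
      using gen(1) unfolding I by (simp only: ideal_gen_mult)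
    then have "(*) (X ^ ?r * Y ^ ?s) ` {X ^ ?m, (X + Y) ^ ?C} \<subseteq> I"
      using gen(3) fK by simp
    then show ?thesis
      unfolding I by (rule ideal_gen_times_image[OF g])
  qed
  have cases: "?r \<le> i \<and> ?s \<le> j \<and> (?r + ?C \<le> i \<or> ?m + ?C \<le> 2 * (i - ?r) + 1 + (j - ?s))"
    if "?r < M" "g \<in> I" "g \<noteq> 0" "lead_monomial le g = (i, j)" "i < M" "j < N" for g i j
  proof -
    have "g \<in> ideal_gen {X ^ (?r + ?m), Y ^ N, X ^ ?r * Y ^ ?s * (X + Y) ^ ?C}"
      using that(1,2) unfolding I fK by simp
    then show ?thesis
      by (rule lead_monomial_cases[OF order x_gt_y char'[OF that(1)]]) (use that in simp_all)
  qed
  note lead_X_Y = lead_monomial_X_power[OF order] lead_monomial_Y_power[OF order]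
    X_power_neq_0 Y_power_neq_0
  {
    assume *: "M \<le> ?r \<or> N \<le> ?s"
    have "groebner_basis le {X ^ M, Y ^ N} I \<and>
        init_ideal le I = ideal_gen ((\<lambda>m. Poly_Mapping.single m 1) ` {(M, 0), (0, N)})"
    proof (rule groebner_basis_of_lead_monomials[OF order])
      fix g i j assume g: "g \<in> I" "g \<noteq> 0" "lead_monomial le g = (i, j)"
      obtain A B D where g_eq: "g = A * X ^ M + B * Y ^ N + D * f ^ K"
        using g(1) unfolding I by (rule ideal_gen_tripleE)
      \<comment> \<open>In this case \<open>f^K\<close> is itself a multiple of \<open>X^M\<close>
        or of \<open>Y^N\<close>.\<close>
      have "Poly_Mapping.lookup g (i, j) = 0" if "i < M" "j < N"
      proof -
        from * have "Poly_Mapping.lookup (D * f ^ K) (i, j) = 0"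
        proof
          assume "M \<le> ?r"
          moreover have "D * f ^ K = D * Y ^ ?s * (X + Y) ^ ?C * X ^ ?r"
            unfolding fK by (simp only: mult_ac)
          ultimately show ?thesis
            using that by (simp add: X_power[of ?r] lookup_times_single)
        next
          assume "N \<le> ?s"
          moreover have "D * f ^ K = D * X ^ ?r * (X + Y) ^ ?C * Y ^ ?s"
            unfolding fK by (simp only: mult_ac)
          ultimately show ?thesis
            using that by (simp add: Y_power[of ?s] lookup_times_single)
        qed
        then show ?thesis
          using that by (simp add: g_eq lookup_add X_power Y_power lookup_times_single)
      qed
      moreover have "Poly_Mapping.lookup g (i, j) \<noteq> 0"
        using lead_monomial_greatest(1)[OF order g(2)] g(3) by (simp add: in_keys_iff)
      ultimately have "M \<le> i \<or> N \<le> j"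
        by (meson not_less)
      then show "\<exists>(k, l)\<in>{(M, 0), (0, N)}. k \<le> i \<and> l \<le> j"
        by auto
    qed (use gen in \<open>auto simp: lead_X_Y\<close>)
    then show "groebner_basis le {X ^ M, Y ^ N} I" ..
  }
  {
    assume "?r < M" "?s < N" "M \<le> (a + c) * K"
    then have "?m \<le> ?C"
      by (simp add: add_mult_distrib)
    note char' = char'[OF \<open>?r < M\<close>]
    let ?mon = "\<lambda>t. (M - t - 1, (a + b + c) * K - M + 2 * t + 1)"
    let ?G = "{X ^ M :: 'k poly2, Y ^ N} \<union> {polyH M K a b c t | t. t < ?m}"
    have H_in: "polyH M K a b c t \<in> I" if "t < ?m" for t
      unfolding polyH_factor[OF \<open>?m \<le> ?C\<close> that]
      by (intro mult_I gap_element_in_ideal) (use char' that \<open>?r < M\<close> in auto)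
    note lead = polyH_lead[OF order x_gt_y char' \<open>?m \<le> ?C\<close>]
    have "groebner_basis le ?G I \<and> init_ideal le I =
        ideal_gen ((\<lambda>m. Poly_Mapping.single m 1) ` ({(M, 0), (0, N)} \<union> ?mon ` {..<?m}))"
    proof (rule groebner_basis_of_lead_monomials[OF order])
      show "lead_monomial le ` ?G = {(M, 0), (0, N)} \<union> ?mon ` {..<?m}"
      proof -
        have "lead_monomial le ` {polyH M K a b c t :: 'k poly2 | t. t < ?m} = ?mon ` {..<?m}"
          unfolding Setcompr_less_eq_image image_image by (rule image_cong) (simp_all add: lead(1))
        then show ?thesis
          by (simp add: image_Un lead_X_Y)
      qed
      fix g i j assume g: "g \<in> I" "g \<noteq> 0" "lead_monomial le g = (i, j)"
      show "\<exists>(k, l)\<in>{(M, 0), (0, N)} \<union> ?mon ` {..<?m}. k \<le> i \<and> l \<le> j"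
      proof (cases "i < M \<and> j < N")
        case True
        \<comment> \<open>Since \<open>i < M\<close> \<le> \<open>(a + c) * K\<close>, the
          alternative \<open>?r + ?C\<close> \<le> \<open>i\<close> is excluded. The choice
          \<open>t = M - 1 - i\<close> then matches the \<open>x\<close> exponent exactly, and the
          bound on \<open>j\<close> is the required inequality.\<close>
        then have ij: "?r \<le> i" "?s \<le> j" "?m + ?C \<le> 2 * (i - ?r) + 1 + (j - ?s)"
          using cases[OF \<open>?r < M\<close> g] \<open>M \<le> (a + c) * K\<close> by (auto simp: add_mult_distrib)
        have "M - (M - 1 - i) - 1 \<le> i" "(a + b + c) * K - M + 2 * (M - 1 - i) + 1 \<le> j"
          "M - 1 - i < ?m"
          using ij True \<open>?m \<le> ?C\<close> by (auto simp: add_mult_distrib)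
        then show ?thesis
          by (intro bexI[of _ "?mon (M - 1 - i)"]) auto
      qed (auto simp: not_less)
    qed (use gen H_in lead(2) in \<open>auto simp: lead_X_Y\<close>)
    moreover have "(\<lambda>m. Poly_Mapping.single m (1 :: 'k)) ` ({(M, 0), (0, N)} \<union> ?mon ` {..<?m}) =
        {X ^ M, Y ^ N} \<union> {X ^ (M - t - 1) * Y ^ ((a + b + c) * K - M + 2 * t + 1) | t. t < ?m}"
      unfolding Setcompr_less_eq_image monomial_conv X_power[of M] Y_power[of N]
      by (simp add: image_Un image_image)
    ultimately show "groebner_basis le ?G I"
      "init_ideal le I = ideal_gen ({X ^ M, Y ^ N} \<union>
        {X ^ (M - t - 1) * Y ^ ((a + b + c) * K - M + 2 * t + 1) | t. t < ?m})"
      by simp_all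
  }
  {
    assume "?r < M" "?s < N" "(a + c) * K < M"
    then have "?C \<le> ?m"
      by (simp add: add_mult_distrib)
    note char' = char'[OF \<open>?r < M\<close>]
    let ?mon = "\<lambda>t. ((a + c) * K - t - 1, M + ?s - (a + c) * K + 2 * t + 1)"
    let ?f = "X ^ ?r * Y ^ ?s * (X + Y) ^ ?C :: 'k poly2"
    let ?G = "{X ^ M :: 'k poly2, Y ^ N, ?f} \<union> {polyL M K a b c t | t. t < ?C}"
    \<comment> \<open>With \<open>U = X + Y\<close> and \<open>V = - Y\<close> the sum
      \<open>U + V\<close> is \<open>X\<close>, so the same ideal arises with the exponents
      \<open>?C\<close> and \<open>?m\<close> exchanged.\<close>
    have swap: "{(X + Y) ^ ?C, (X + Y + - Y) ^ ?m} = {X ^ ?m, (X + Y) ^ ?C :: 'k poly2}"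
      by (simp add: insert_commute)
    have "CHAR('k) = 0 \<or> ?C \<le> CHAR('k)"
      using char' by auto
    note gap_element = gap_element_in_ideal[OF this, of _ ?m "X + Y" "- Y", unfolded swap]
    have L_in: "polyL M K a b c t \<in> I" if "t < ?C" for t
      unfolding polyL_factor[OF \<open>?C \<le> ?m\<close> that \<open>?r < M\<close>]
      by (intro mult_I gap_element that \<open>?r < M\<close>)
    note lead = polyL_lead[OF order x_gt_y char' \<open>?C \<le> ?m\<close> _ \<open>?r < M\<close>]
    have lead_f: "lead_monomial le ?f = ((a + c) * K, ?s)" "?f \<noteq> (0 :: 'k poly2)"
      using lead_monomial_sum_single[OF order x_gt_y, of "\<lambda>i. of_nat (?C choose i) :: 'k" ?C ?C ?r ?s]
      unfolding X_Y_XY_conv by (simp_all add: add_mult_distrib)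
    have "groebner_basis le ?G I \<and> init_ideal le I = ideal_gen ((\<lambda>m. Poly_Mapping.single m 1) `
        ({(M, 0), (0, N), ((a + c) * K, ?s)} \<union> ?mon ` {..<?C}))"
    proof (rule groebner_basis_of_lead_monomials[OF order])
      show "lead_monomial le ` ?G = {(M, 0), (0, N), ((a + c) * K, ?s)} \<union> ?mon ` {..<?C}"
      proof -
        have "lead_monomial le ` {polyL M K a b c t :: 'k poly2 | t. t < ?C} = ?mon ` {..<?C}"
          unfolding Setcompr_less_eq_image image_image by (rule image_cong) (simp_all add: lead(1))
        then show ?thesis
          by (simp add: image_Un lead_X_Y lead_f)
      qed
      fix g i j assume g: "g \<in> I" "g \<noteq> 0" "lead_monomial le g = (i, j)"
      show "\<exists>(k, l)\<in>{(M, 0), (0, N), ((a + c) * K, ?s)} \<union> ?mon ` {..<?C}. k \<le> i \<and> l \<le> j"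
      \<comment> \<open>Below \<open>(a + c) * K\<close> the witness \<open>?t\<close> makes the
        \<open>x\<close> exponent equal to \<open>i\<close>. From there on, \<open>?s\<close> \<le>
        \<open>j\<close> gives divisibility by the leading monomial of \<open>f^K\<close>, unless a
        pure power already divides.\<close>
      proof (cases "i < M \<and> j < N \<and> i < (a + c) * K")
        case True
        then have ij: "?r \<le> i" "?s \<le> j" "?m + ?C \<le> 2 * (i - ?r) + 1 + (j - ?s)"
          using cases[OF \<open>?r < M\<close> g] by (auto simp: add_mult_distrib)
        let ?t = "(a + c) * K - 1 - i"
        have "(a + c) * K - ?t - 1 \<le> i" "M + ?s - (a + c) * K + 2 * ?t + 1 \<le> j" "?t < ?C"
          using ij True \<open>?C \<le> ?m\<close> by (auto simp: add_mult_distrib)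
        then show ?thesis
          by (intro bexI[of _ "?mon ?t"]) auto
      next
        case False
        then show ?thesis
          using cases[OF \<open>?r < M\<close> g] by (auto simp: not_less)
      qed
    qed (use gen L_in lead(2) lead_f(2) in \<open>auto simp: lead_X_Y fK\<close>)
    moreover have "(\<lambda>m. Poly_Mapping.single m (1 :: 'k)) `
          ({(M, 0), (0, N), ((a + c) * K, ?s)} \<union> ?mon ` {..<?C}) =
        {X ^ M, Y ^ N, X ^ ((a + c) * K) * Y ^ ?s} \<union>
        {X ^ ((a + c) * K - t - 1) * Y ^ (M + ?s - (a + c) * K + 2 * t + 1) | t. t < ?C}"
      unfolding Setcompr_less_eq_image monomial_conv X_power[of M] Y_power[of N]
      by (simp add: image_Un image_image)
    ultimately show "groebner_basis le ?G I"
      "init_ideal le I = ideal_gen ({X ^ M, Y ^ N, X ^ ((a + c) * K) * Y ^ ?s} \<union>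
        {X ^ ((a + c) * K - t - 1) * Y ^ (M + ?s - (a + c) * K + 2 * t + 1) | t. t < ?C})"
      by simp_all
  }
qed

end
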